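(* Let $X=\{x_1,\dots,x_n\}$ be positive integers with $\sum_{i=1}^n x_i=2B$, and let $I$ be the instance of $(1 \mid p\mathrm{MA} \mid \sum_j C_j)$ constructed from $X$ as described in the context. If there is a subset $X_1\subset X$ with $\sum_{x\in X_1}x=B$, then there is a feasible schedule for $I$ with total completion time at most $Q=Q_0+B$.
   Context: Problem $(1 \mid p\mathrm{MA} \mid \sum_j C_j)$: a single machine with maintenance level initially $\mathrm{ML}_0$ and maximum $\mathrm{ML}^{\max}$; each job $J_i$ has non-preemptive processing time $p_i$ and deterioration $\delta_i$, and processing it decreases the level by $\delta_i$; the level must never be negative; maintenance activities (MAs) of any duration $D\in[0,\mathrm{ML}^{\max}-\mathrm{ML}]$ ($\mathrm{ML}$ the current level) may be inserted, occupying the machine for time $D$ and raising the level by $D$. The objective is the total completion time $\sum_i C_i$. Construction of $I$ from $X$: there are $2n+3$ jobs $J_0,\dots,J_{2n+2}$. Fix an integer $M>(4n+8)B$. For $i=0,1,\dots,n$: $p_i=p_{n+1+i}=\sum_{j=1}^i x_j$ (so $p_0=0$) and $\delta_i=\delta_{n+1+i}=M-2p_i$. Also $p_{2n+2}=M-2B$, $\delta_{2n+2}=0$. The initial maintenance level is $\mathrm{ML}_0=\sum_{i=0}^n\delta_i-2B$ and the maximum maintenance level is $\mathrm{ML}^{\max}=\sum_{i=0}^n\delta_i$. Define $$Q_0=\sum_{j=0}^n(n-j+1)p_j+(n+2)\Big(\sum_{j=0}^np_j+2B+p_{2n+2}\Big)+\sum_{j=0}^n(j+1)(p_{n+1+j}+\delta_{n+1+j}),$$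 and $Q=Q_0+B$. *)

theory Defs
  imports Complex_Main
begin

record pma_instance =
  jobs :: "nat set"
  ptime :: "nat \<Rightarrow> real"
  deter :: "nat \<Rightarrow> real"
  ml_init :: real
  ml_max :: real

datatype activity = Job nat | MA real

fun duration :: "pma_instance \<Rightarrow> activity \<Rightarrow> real" where
  "duration I (Job i) = ptime I i"
| "duration I (MA D) = D"

(* A schedule lists, in processing order, the activities together with their
   start times.  Idle time between consecutive activities is permitted. *)
type_synonym schedule = "(real \<times> activity) list"

(* levels_ok I ml as: starting from maintenance level ml, performing the
   activities as in order never makes the level negative, and every MA has an
   admissible duration.  The level is monotone during each activity, so it is
   enough to test it at the beginning and end of each. *)
fun levels_ok :: "pma_instance \<Rightarrow> real \<Rightarrow> activity list \<Rightarrow> bool" where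
  "levels_ok I ml [] \<longleftrightarrow> 0 \<le> ml"
| "levels_ok I ml (Job i # as) \<longleftrightarrow> 0 \<le> ml \<and> levels_ok I (ml - deter I i) as"
| "levels_ok I ml (MA D # as) \<longleftrightarrow>
     0 \<le> ml \<and> 0 \<le> D \<and> D \<le> ml_max I - ml \<and> levels_ok I (ml + D) as"

definition job_sequence :: "schedule \<Rightarrow> nat list" where
  "job_sequence s = [i. (t, Job i) \<leftarrow> s]"

definition feasible :: "pma_instance \<Rightarrow> schedule \<Rightarrow> bool" where
  "feasible I s \<longleftrightarrow>
     distinct (job_sequence s) \<and> set (job_sequence s) = jobs I \<and>
     (\<forall>(t, a) \<in> set s. 0 \<le> t) \<and>
     sorted_wrt (\<lambda>(t, a) (t', a'). t + duration I a \<le> t') s \<and>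
     levels_ok I (ml_init I) (map snd s)"

(* Well defined for feasible schedules, where every job occurs exactly once. *)
definition completion_time :: "pma_instance \<Rightarrow> schedule \<Rightarrow> nat \<Rightarrow> real" where
  "completion_time I s i = (THE t. (t, Job i) \<in> set s) + ptime I i"

definition total_completion_time :: "pma_instance \<Rightarrow> schedule \<Rightarrow> real" where
  "total_completion_time I s = (\<Sum>i\<in>jobs I. completion_time I s i)"

(* The instance built from x 1, ..., x n.  Jobs i and n + 1 + i, for i \<le> n, are
   twins whose processing time is the i-th prefix sum. *)

definition red_p :: "nat \<Rightarrow> (nat \<Rightarrow> int) \<Rightarrow> int \<Rightarrow> int \<Rightarrow> nat \<Rightarrow> int" where
  "red_p n x B M k =
     (if k \<le> n then \<Sum>j=1..k. x j
      else if k \<le> 2 * n + 1 then \<Sum>j=1..k - (n + 1). x j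
      else M - 2 * B)"

definition red_delta :: "nat \<Rightarrow> (nat \<Rightarrow> int) \<Rightarrow> int \<Rightarrow> int \<Rightarrow> nat \<Rightarrow> int" where
  "red_delta n x B M k = (if k \<le> 2 * n + 1 then M - 2 * red_p n x B M k else 0)"

definition red_instance :: "nat \<Rightarrow> (nat \<Rightarrow> int) \<Rightarrow> int \<Rightarrow> int \<Rightarrow> pma_instance" where
  "red_instance n x B M =
     \<lparr> jobs = {0..2 * n + 2},
       ptime = (\<lambda>k. real_of_int (red_p n x B M k)),
       deter = (\<lambda>k. real_of_int (red_delta n x B M k)),
       ml_init = real_of_int ((\<Sum>i=0..n. red_delta n x B M i) - 2 * B),
       ml_max = real_of_int (\<Sum>i=0..n. red_delta n x B M i) \<rparr>"

definition Q0 :: "nat \<Rightarrow> (nat \<Rightarrow> int) \<Rightarrow> int \<Rightarrow> int \<Rightarrow> int" where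
  "Q0 n x B M =
     (\<Sum>j=0..n. (int n - int j + 1) * red_p n x B M j)
     + (int n + 2) * ((\<Sum>j=0..n. red_p n x B M j) + 2 * B + red_p n x B M (2 * n + 2))
     + (\<Sum>j=0..n. (int j + 1) * (red_p n x B M (n + 1 + j) + red_delta n x B M (n + 1 + j)))"

end

theory Submission
  imports Defs
begin

text \<open>
  Write $P_k = x_1 + \dots + x_k$ and let $S$ index a subset of sum $B$. Before the long job, run
  $n+1$ jobs whose $k$-th processing time is $P_{k+1}$ if $k+1 \in S$ and $P_k$ otherwise. Compared
  with running $J_0,\dots,J_n$ this adds $B$ to the processing time and so removes $2B$ from the
  deterioration, which then exhausts the initial level exactly; no maintenance is needed up to
  that point. The remaining $n+1$ jobs, longest first, are each preceded by a maintenance activity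
  of exactly their deterioration. Relative to $Q_0$, each $i \in S$ costs $(n-i+2)x_i$ in the first
  part and $(i+1)x_i$ in the last, while starting the long job $B$ earlier saves $(n+2)B$. The
  balance is $(n+3)B - (n+2)B = B$.
\<close>

section \<open>Schedules without idle time\<close>

fun schedule_from :: "pma_instance \<Rightarrow> real \<Rightarrow> activity list \<Rightarrow> schedule" where
  "schedule_from I t [] = []"
| "schedule_from I t (a # as) = (t, a) # schedule_from I (t + duration I a) as"

fun jobs_of :: "activity list \<Rightarrow> nat list" where
  "jobs_of [] = []"
| "jobs_of (Job i # as) = i # jobs_of as"
| "jobs_of (MA D # as) = jobs_of as"

text \<open>Recursive form of the objective: it reads start times off the schedule itself instead of
  recovering them through \<open>THE\<close>, so it can be computed by induction on the activity
  list.\<close>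

fun sum_completions :: "pma_instance \<Rightarrow> schedule \<Rightarrow> real" where
  "sum_completions I [] = 0"
| "sum_completions I ((t, Job i) # s) = t + ptime I i + sum_completions I s"
| "sum_completions I ((t, MA D) # s) = sum_completions I s"

lemma map_snd_schedule_from [simp]: "map snd (schedule_from I t as) = as"
  by (induction as arbitrary: t) auto

lemma job_sequence_eq_jobs_of: "job_sequence s = jobs_of (map snd s)"
  unfolding job_sequence_def
  by (induction s) (auto split: activity.split)

lemma jobs_of_append [simp]: "jobs_of (as @ bs) = jobs_of as @ jobs_of bs"
  by (induction as rule: jobs_of.induct) auto

lemma jobs_of_map_Job [simp]: "jobs_of (map (\<lambda>k. Job (f k)) ks) = map f ks"
  by (induction ks) auto

lemma jobs_of_maintained [simp]:
  "jobs_of (concat (map (\<lambda>k. [MA (d k), Job (g k)]) ks)) = map g ks"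
  by (induction ks) auto

lemma schedule_from_start_ge:
  assumes "\<And>a. a \<in> set as \<Longrightarrow> 0 \<le> duration I a" "(u, b) \<in> set (schedule_from I t as)"
  shows "t \<le> u"
  using assms
proof (induction as arbitrary: t)
  case (Cons a as)
  show ?case
  proof (cases "(u, b) = (t, a)")
    case False
    then have "t + duration I a \<le> u"
      using Cons by auto
    moreover have "0 \<le> duration I a"
      using Cons.prems(1) by simp
    ultimately show ?thesis
      by linarith
  qed auto
qed simp

lemma schedule_from_sorted:
  assumes "\<And>a. a \<in> set as \<Longrightarrow> 0 \<le> duration I a"
  shows "sorted_wrt (\<lambda>(t, a) (t', a'). t + duration I a \<le> t') (schedule_from I t as)"
  using assms
proof (induction as arbitrary: t)
  case (Cons a as)
  have "t + duration I a \<le> u" if "(u, b) \<in> set (schedule_from I (t + duration I a) as)" for u b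
    using schedule_from_start_ge[OF _ that] Cons.prems by simp
  then show ?case
    using Cons by auto
qed simp

text \<open>With nonnegative durations, back-to-back starting from time 0 settles all timing
  conditions, so feasibility becomes a property of the activity list alone.\<close>

lemma feasible_schedule_from:
  assumes "distinct (jobs_of as)" "set (jobs_of as) = jobs I"
    and "\<And>a. a \<in> set as \<Longrightarrow> 0 \<le> duration I a" "levels_ok I (ml_init I) as"
  shows "feasible I (schedule_from I 0 as)"
  using assms schedule_from_sorted[of as I 0] schedule_from_start_ge[of as I _ _ 0]
  unfolding feasible_def by (auto simp: job_sequence_eq_jobs_of)

section \<open>Total completion time, computed along the schedule\<close>

lemma in_job_sequence: "(t, Job i) \<in> set s \<Longrightarrow> i \<in> set (job_sequence s)"
  unfolding job_sequence_def by force

text \<open>Distinctness makes the \<open>THE\<close> in \<open>completion_time\<close> resolve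
  correctly: a job at the head does not recur in the tail, and for all other jobs the head entry is
  invisible.\<close>

lemma sum_completion_time:
  assumes "distinct (job_sequence s)"
  shows "(\<Sum>i\<in>set (job_sequence s). completion_time I s i) = sum_completions I s"
  using assms
proof (induction s)
  case Nil
  then show ?case by (simp add: job_sequence_def)
next
  case (Cons ta s)
  obtain t a where ta: "ta = (t, a)"
    by fastforce
  show ?case
  proof (cases a)
    case (Job i)
    have seq: "job_sequence (ta # s) = i # job_sequence s"
      by (simp add: ta Job job_sequence_eq_jobs_of)
    then have i: "i \<notin> set (job_sequence s)" and IH:
      "(\<Sum>j\<in>set (job_sequence s). completion_time I s j) = sum_completions I s"
      using Cons by auto
    have "(THE u. (u, Job i) \<in> set (ta # s)) = t"
      using i in_job_sequence[of _ i s] by (intro the_equality) (auto simp: ta Job)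
    then have "completion_time I (ta # s) i = t + ptime I i"
      by (simp add: completion_time_def)
    moreover have "completion_time I (ta # s) j = completion_time I s j"
      if "j \<in> set (job_sequence s)" for j
    proof -
      have "j \<noteq> i"
        using that i by blast
      then show ?thesis
        by (simp add: completion_time_def ta Job)
    qed
    ultimately show ?thesis
      using i IH by (simp add: seq) (simp add: ta Job)
  next
    case (MA D)
    have seq: "job_sequence (ta # s) = job_sequence s"
      by (simp add: ta MA job_sequence_eq_jobs_of)
    have "completion_time I (ta # s) j = completion_time I s j" for j
      by (simp add: completion_time_def ta MA)
    then show ?thesis
      using Cons by (simp add: seq) (simp add: ta MA)
  qed
qed

lemma total_completion_time_eq:
  assumes "feasible I s"
  shows "total_completion_time I s = sum_completions I s"
  using assms sum_completion_time[of s I]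
  by (simp add: feasible_def total_completion_time_def)

section \<open>Closed forms for the cost of the two kinds of runs\<close>

lemma sum_completions_Job_Cons [simp]:
  "sum_completions I (schedule_from I t (Job i # as)) =
     t + ptime I i + sum_completions I (schedule_from I (t + ptime I i) as)"
  by simp

lemma sum_completions_append:
  "sum_completions I (schedule_from I t (as @ bs)) =
     sum_completions I (schedule_from I t as) +
     sum_completions I (schedule_from I (t + sum_list (map (duration I) as)) bs)"
proof (induction as arbitrary: t)
  case (Cons a as)
  then show ?case by (cases a) (auto simp: add.assoc)
qed simp

text \<open>The job at position \<open>j\<close>, counted from 0, delays itself and the
  \<open>m - j - 1\<close> jobs after it, hence the weight \<open>m - j\<close>; the initial offset
  delays all \<open>m\<close> jobs.\<close>

lemma sum_completions_map_Job:
  "sum_completions I (schedule_from I t (map (\<lambda>k. Job (f k)) [0..<m])) =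
     real m * t + (\<Sum>j<m. (real m - real j) * ptime I (f j))"
proof (induction m)
  case (Suc m)
  have "(\<Sum>j<m. (real (Suc m) - real j) * ptime I (f j)) =
        (\<Sum>j<m. (real m - real j) * ptime I (f j)) + (\<Sum>j<m. ptime I (f j))"
    by (simp add: algebra_simps sum.distrib[symmetric])
  then show ?case
    using Suc
    by (simp add: sum_completions_append sum_list_sum_nth atLeast0LessThan algebra_simps)
qed simp

text \<open>In the reversed order pair \<open>j\<close> is followed by the pairs with indices below
  \<open>j\<close>, so its whole length, maintenance included, enters \<open>j + 1\<close>
  completion times. The reversal lets the induction peel pair \<open>m\<close> off the front, which
  is why \<open>t\<close> must vary.\<close>

lemma sum_completions_maintained:
  "sum_completions I
     (schedule_from I t (concat (map (\<lambda>k. [MA (d k), Job (g k)]) (rev [0..<m])))) =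
   real m * t + (\<Sum>j<m. (real j + 1) * (d j + ptime I (g j)))"
proof (induction m arbitrary: t)
  case (Suc m)
  show ?case
    using Suc[of "t + d m + ptime I (g m)"] by (simp add: algebra_simps)
qed simp

section \<open>Maintenance levels along the two kinds of runs\<close>

lemma levels_ok_map_Job_append:
  assumes "\<And>k. k \<in> set ks \<Longrightarrow> 0 \<le> deter I (f k)"
    and "0 \<le> ml - (\<Sum>k\<leftarrow>ks. deter I (f k))"
    and "levels_ok I (ml - (\<Sum>k\<leftarrow>ks. deter I (f k))) as"
  shows "levels_ok I ml (map (\<lambda>k. Job (f k)) ks @ as)"
  using assms
proof (induction ks arbitrary: ml)
  case (Cons k ks)
  \<comment> \<open>The level only falls during the run, so nonnegativity at its end carries back to
    every intermediate level.\<close>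
  have "0 \<le> (\<Sum>k\<leftarrow>ks. deter I (f k))"
    using Cons.prems(1) by (auto intro!: sum_list_nonneg)
  moreover have "0 \<le> deter I (f k)"
    using Cons.prems(1) by simp
  moreover have "levels_ok I (ml - deter I (f k)) (map (\<lambda>k. Job (f k)) ks @ as)"
    using Cons.IH[of "ml - deter I (f k)"] Cons.prems by (simp add: algebra_simps)
  moreover have "deter I (f k) + (\<Sum>k\<leftarrow>ks. deter I (f k)) \<le> ml"
    using Cons.prems(2) by simp
  ultimately show ?case
    by simp
qed simp

text \<open>Each maintenance activity lifts the level from 0 to exactly what the next job consumes,
  so every pair ends at level 0 again.\<close>

lemma levels_ok_maintained:
  assumes "\<And>k. k \<in> set ks \<Longrightarrow> 0 \<le> deter I (g k) \<and> deter I (g k) \<le> ml_max I"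
  shows "levels_ok I 0 (concat (map (\<lambda>k. [MA (deter I (g k)), Job (g k)]) ks))"
  using assms by (induction ks) auto

section \<open>The reduction\<close>

definition early_job :: "nat \<Rightarrow> nat set \<Rightarrow> nat \<Rightarrow> nat" where
  "early_job n S k = (if Suc k \<in> S then n + 1 + Suc k else k)"

text \<open>Counterpart of \<open>early_job\<close>: each \<open>k \<in> S\<close> exchanges job
  \<open>k - 1\<close> with job \<open>n + 1 + k\<close>, the former moving to late position
  \<open>k\<close> and the latter to early position \<open>k - 1\<close>.\<close>

definition late_job :: "nat \<Rightarrow> nat set \<Rightarrow> nat \<Rightarrow> nat" where
  "late_job n S k = (if k \<in> S then k - 1 else n + 1 + k)"

text \<open>The two maps arise from the split into \<open>{0..n}\<close> and
  \<open>{n+1..2n+1}\<close> by disjoint transpositions, one for each element of \<open>S\<close>.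
  As \<open>0 \<notin> S\<close>, the truncated \<open>k - 1\<close> is a genuine
  predecessor.\<close>

lemma early_late_partition:
  assumes "S \<subseteq> {1..n}"
  shows "inj_on (early_job n S) {0..<Suc n}" "inj_on (late_job n S) {0..<Suc n}"
    and "early_job n S ` {0..<Suc n} \<inter> late_job n S ` {0..<Suc n} = {}"
    and "early_job n S ` {0..<Suc n} \<union> late_job n S ` {0..<Suc n} = {0..2 * n + 1}"
proof -
  show "inj_on (early_job n S) {0..<Suc n}"
    by (auto simp: inj_on_def early_job_def split: if_splits)
  have pos: "0 < k" if "k \<in> S" for k
    using assms that by force
  show "inj_on (late_job n S) {0..<Suc n}"
    using pos by (auto simp: inj_on_def late_job_def split: if_splits)
      (metis Suc_pred)
  show "early_job n S ` {0..<Suc n} \<inter> late_job n S ` {0..<Suc n} = {}"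
    using pos by (auto simp: early_job_def late_job_def split: if_splits)
  show "early_job n S ` {0..<Suc n} \<union> late_job n S ` {0..<Suc n} = {0..2 * n + 1}"
    (is "?E \<union> ?L = _")
  proof (intro equalityI subsetI)
    fix i assume "i \<in> ?E \<union> ?L"
    then show "i \<in> {0..2 * n + 1}"
      using assms by (auto simp: early_job_def late_job_def split: if_splits)
  next
    fix i assume i: "i \<in> {0..2 * n + 1}"
    show "i \<in> ?E \<union> ?L"
    proof (cases "i \<le> n")
      case True
      show ?thesis
      proof (cases "Suc i \<in> S")
        case S: True
        then have "i = late_job n S (Suc i)" "Suc i \<in> {0..<Suc n}"
          using assms by (auto simp: late_job_def)
        then show ?thesis by blast
      next
        case False
        then have "i = early_job n S i" "i \<in> {0..<Suc n}"
          using True by (auto simp: early_job_def)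
        then show ?thesis by blast
      qed
    next
      case False
      define k where "k = i - (n + 1)"
      have k: "i = n + 1 + k" "k \<in> {0..<Suc n}"
        using False i by (auto simp: k_def)
      show ?thesis
      proof (cases "k \<in> S")
        case True
        then have "i = early_job n S (k - 1)" "k - 1 \<in> {0..<Suc n}"
          using k pos[OF True] by (auto simp: early_job_def)
        then show ?thesis by blast
      next
        case False
        then have "i = late_job n S k"
          using k by (auto simp: late_job_def)
        then show ?thesis using k(2) by blast
      qed
    qed
  qed
qed

section \<open>Processing times and deteriorations after the exchange\<close>

lemma red_p_early_job:
  assumes "S \<subseteq> {1..n}" "k \<le> n"
  shows "red_p n x B M (early_job n S k) =
    red_p n x B M k + (if Suc k \<in> S then x (Suc k) else 0)"
  \<comment> \<open>\<open>Suc k \<in> S\<close> forces \<open>Suc k \<le> n\<close>, so the index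
    \<open>n + 1 + Suc k\<close> stays below that of the long job \<open>2 * n + 2\<close>.\<close>
  using assms by (force simp: red_p_def early_job_def)

lemma red_p_late_job:
  assumes "S \<subseteq> {1..n}" "k \<le> n"
  shows "red_p n x B M (late_job n S k) = red_p n x B M k - (if k \<in> S then x k else 0)"
proof (cases "k \<in> S")
  case True
  then obtain j where "k = Suc j"
    using assms by (cases k) auto
  then show ?thesis
    using True assms by (simp add: red_p_def late_job_def)
qed (use assms in \<open>simp add: red_p_def late_job_def\<close>)

lemma red_p_twin: "k \<le> n \<Longrightarrow> red_p n x B M (n + 1 + k) = red_p n x B M k"
  by (simp add: red_p_def)

lemma red_p_bounds:
  assumes "\<And>i. i \<in> {1..n} \<Longrightarrow> 0 < x i" "(\<Sum>i=1..n. x i) = 2 * B" "k \<le> 2 * n + 1"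
  shows "0 \<le> red_p n x B M k" "red_p n x B M k \<le> 2 * B"
proof -
  have *: "0 \<le> (\<Sum>j=1..m. x j) \<and> (\<Sum>j=1..m. x j) \<le> 2 * B" if "m \<le> n" for m
  proof
    show "0 \<le> (\<Sum>j=1..m. x j)"
      using assms(1) that by (intro sum_nonneg) (simp add: order_less_imp_le)
    have "(\<Sum>j=1..m. x j) \<le> (\<Sum>j=1..n. x j)"
      using assms(1) that by (intro sum_mono2) (auto simp: order_less_imp_le)
    then show "(\<Sum>j=1..m. x j) \<le> 2 * B"
      using assms(2) by simp
  qed
  show "0 \<le> red_p n x B M k" "red_p n x B M k \<le> 2 * B"
    using *[of k] *[of "k - (n + 1)"] assms(3) by (auto simp: red_p_def)
qed

text \<open>Turns position-indexed corrections into sums over \<open>S\<close>. The shifted version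
  loses nothing at the ends of the range because neither \<open>0\<close> nor \<open>Suc n\<close>
  lies in \<open>S\<close>.\<close>

lemma sum_over_subset:
  fixes h :: "nat \<Rightarrow> int"
  assumes "S \<subseteq> {1..n}"
  shows "(\<Sum>j<Suc n. if j \<in> S then h j else 0) = (\<Sum>i\<in>S. h i)"
    and "(\<Sum>j<Suc n. if Suc j \<in> S then h (Suc j) else 0) = (\<Sum>i\<in>S. h i)"
proof -
  have "{..<Suc n} \<inter> S = S"
    using assms by force
  then show 1: "(\<Sum>j<Suc n. if j \<in> S then h j else 0) = (\<Sum>i\<in>S. h i)"
    by (simp only: finite_lessThan flip: sum.inter_restrict)
  have "0 \<notin> S" "Suc n \<notin> S"
    using assms by auto
  then show "(\<Sum>j<Suc n. if Suc j \<in> S then h (Suc j) else 0) = (\<Sum>i\<in>S. h i)"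
    using 1 sum.lessThan_Suc_shift[of "\<lambda>j. if j \<in> S then h j else 0" n]
    by simp
qed

lemma sum_red_p_early_job:
  assumes "S \<subseteq> {1..n}" "(\<Sum>i\<in>S. x i) = B"
  shows "(\<Sum>j<Suc n. red_p n x B M (early_job n S j)) = (\<Sum>j<Suc n. red_p n x B M j) + B"
proof -
  have "(\<Sum>j<Suc n. red_p n x B M (early_job n S j)) =
        (\<Sum>j<Suc n. red_p n x B M j + (if Suc j \<in> S then x (Suc j) else 0))"
    by (intro sum.cong) (auto simp: red_p_early_job[OF assms(1)])
  then show ?thesis
    using sum_over_subset(2)[OF assms(1), of x] assms(2) by (simp only: sum.distrib)
qed

lemma early_job_le: "S \<subseteq> {1..n} \<Longrightarrow> k \<le> n \<Longrightarrow> early_job n S k \<le> 2 * n + 1"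
  by (auto simp: early_job_def)

lemma late_job_le: "k \<le> n \<Longrightarrow> late_job n S k \<le> 2 * n + 1"
  by (auto simp: late_job_def)

text \<open>All jobs involved have deterioration \<open>M - 2 * p\<close>, so \<open>B\<close> more
  processing time means \<open>2 * B\<close> less deterioration. This is exactly the amount by which
  the initial level falls short of the maximum.\<close>

lemma sum_red_delta_early_job:
  assumes "S \<subseteq> {1..n}" "(\<Sum>i\<in>S. x i) = B"
  shows "(\<Sum>j<Suc n. red_delta n x B M (early_job n S j)) =
    (\<Sum>j<Suc n. red_delta n x B M j) - 2 * B"
proof -
  have "(\<Sum>j<Suc n. red_delta n x B M (early_job n S j)) =
        (\<Sum>j<Suc n. M - 2 * red_p n x B M (early_job n S j))"
    using early_job_le[OF assms(1)] by (intro sum.cong) (auto simp: red_delta_def)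
  also have "\<dots> = (\<Sum>j<Suc n. M) - 2 * (\<Sum>j<Suc n. red_p n x B M (early_job n S j))"
    by (simp only: sum_subtractf sum_distrib_left)
  also have "\<dots> = (\<Sum>j<Suc n. M) - 2 * (\<Sum>j<Suc n. red_p n x B M j) - 2 * B"
    by (simp only: sum_red_p_early_job[OF assms]) simp
  also have "(\<Sum>j<Suc n. M) - 2 * (\<Sum>j<Suc n. red_p n x B M j) =
      (\<Sum>j<Suc n. M - 2 * red_p n x B M j)"
    by (simp only: sum_subtractf sum_distrib_left)
  also have "\<dots> = (\<Sum>j<Suc n. red_delta n x B M j)"
    by (intro sum.cong) (auto simp: red_delta_def)
  finally show ?thesis .
qed

lemma swapped_cost:
  assumes "S \<subseteq> {1..n}" "(\<Sum>i\<in>S. x i) = B"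
  shows "(\<Sum>j<Suc n. (int (Suc n) - int j) * red_p n x B M (early_job n S j))
    + (int n + 2) * ((\<Sum>j<Suc n. red_p n x B M (early_job n S j)) + red_p n x B M (2 * n + 2))
    + (\<Sum>j<Suc n. (int j + 1) *
        (red_delta n x B M (late_job n S j) + red_p n x B M (late_job n S j)))
    = Q0 n x B M + B" (is "?early + ?mid + ?late = _")
proof -
  let ?p = "red_p n x B M"
  have early: "?early = (\<Sum>j<Suc n. (int n - int j + 1) * ?p j) + (\<Sum>i\<in>S. (int n - int i + 2) * x i)"
  proof -
    \<comment> \<open>The weight \<open>n - j + 1\<close> of position \<open>j\<close> is rewritten
      in terms of the element \<open>i = Suc j\<close> of \<open>S\<close> as
      \<open>n - i + 2\<close>.\<close>
    have "?early = (\<Sum>j<Suc n. (int n - int j + 1) * ?p j +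
        (if Suc j \<in> S then (int n - int (Suc j) + 2) * x (Suc j) else 0))"
      by (intro sum.cong) (auto simp: red_p_early_job[OF assms(1)] algebra_simps)
    then show ?thesis
      using sum_over_subset(2)[OF assms(1), of "\<lambda>i. (int n - int i + 2) * x i"]
      by (simp only: sum.distrib)
  qed
  have late: "?late = (\<Sum>j<Suc n. (int j + 1) * (?p (n + 1 + j) + red_delta n x B M (n + 1 + j)))
      + (\<Sum>i\<in>S. (int i + 1) * x i)"
  proof -
    \<comment> \<open>A maintained pair lasts \<open>(M - 2 * p) + p = M - p\<close>, so a job
      shorter by \<open>x j\<close> makes its pair longer by \<open>x j\<close>; hence the plus
      sign.\<close>
    have "?late = (\<Sum>j<Suc n. (int j + 1) * (?p (n + 1 + j) + red_delta n x B M (n + 1 + j)) +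
        (if j \<in> S then (int j + 1) * x j else 0))"
    proof (intro sum.cong refl)
      fix j assume "j \<in> {..<Suc n}"
      then have j: "j \<le> n" by simp
      have "red_delta n x B M (n + 1 + j) = M - 2 * ?p j"
        using j red_p_twin[OF j, of x B M] by (simp add: red_delta_def)
      moreover have "red_delta n x B M (late_job n S j) = M - 2 * ?p (late_job n S j)"
        using late_job_le[OF j] by (simp add: red_delta_def)
      ultimately show "(int j + 1) * (red_delta n x B M (late_job n S j) + ?p (late_job n S j)) =
          (int j + 1) * (?p (n + 1 + j) + red_delta n x B M (n + 1 + j)) +
          (if j \<in> S then (int j + 1) * x j else 0)"
        by (simp only: red_p_twin[OF j] red_p_late_job[OF assms(1) j]) (simp add: algebra_simps)
    qed
    then show ?thesis
      using sum_over_subset(1)[OF assms(1), of "\<lambda>i. (int i + 1) * x i"]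
      by (simp only: sum.distrib)
  qed
  \<comment> \<open>The two weights of \<open>x i\<close> add up to \<open>n + 3\<close> whatever
    \<open>i\<close> is, so the extra cost depends on \<open>S\<close> only through its sum.\<close>
  have "(\<Sum>i\<in>S. (int n - int i + 2) * x i) + (\<Sum>i\<in>S. (int i + 1) * x i) =
      (\<Sum>i\<in>S. (int n + 3) * x i)"
    unfolding sum.distrib[symmetric] by (intro sum.cong) (auto simp: algebra_simps)
  also have "\<dots> = (int n + 3) * B"
    by (simp add: assms(2) flip: sum_distrib_left)
  finally have S: "(\<Sum>i\<in>S. (int n - int i + 2) * x i) + (\<Sum>i\<in>S. (int i + 1) * x i) =
      (int n + 3) * B" .
  \<comment> \<open>\<open>Q0\<close> charges \<open>2 * B\<close> beyond the prefix sums before the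
    long job; here the charge is only \<open>B\<close>.\<close>
  have mid: "?mid = (int n + 2) * ((\<Sum>j<Suc n. ?p j) + 2 * B + ?p (2 * n + 2)) - (int n + 2) * B"
    by (simp only: sum_red_p_early_job[OF assms]) (simp add: algebra_simps)
  have ivl: "{0..n} = {..<Suc n}"
    by auto
  show ?thesis
    unfolding early mid late Q0_def ivl using S by (simp only: algebra_simps)
qed

theorem theorem4:
  fixes n :: nat and x :: "nat \<Rightarrow> int" and B M :: int
  assumes "\<And>i. i \<in> {1..n} \<Longrightarrow> 0 < x i"
    and "(\<Sum>i=1..n. x i) = 2 * B"
    and "M > (4 * int n + 8) * B"
    and "\<exists>S \<subseteq> {1..n}. (\<Sum>i\<in>S. x i) = B"
  shows "\<exists>s. feasible (red_instance n x B M) s \<and>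
    total_completion_time (red_instance n x B M) s \<le> real_of_int (Q0 n x B M + B)"
proof -
  obtain S where S: "S \<subseteq> {1..n}" "(\<Sum>i\<in>S. x i) = B"
    using assms(4) by blast
  let ?p = "red_p n x B M" and ?d = "red_delta n x B M" and ?e = "early_job n S"
    and ?l = "late_job n S"
  define I where "I = red_instance n x B M"
  have I: "jobs I = {0..2 * n + 2}" "ptime I k = real_of_int (?p k)"
    "deter I k = real_of_int (?d k)" "ml_init I = real_of_int ((\<Sum>i<Suc n. ?d i) - 2 * B)"
    "ml_max I = real_of_int (\<Sum>i<Suc n. ?d i)" for k
    by (simp_all add: I_def red_instance_def atLeast0AtMost lessThan_Suc_atMost)
  define early where "early = map (\<lambda>k. Job (?e k)) [0..<Suc n]"
  define late where
    "late = concat (map (\<lambda>k. [MA (deter I (?l k)), Job (?l k)]) (rev [0..<Suc n]))"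
  define as where "as = early @ Job (2 * n + 2) # late"
  \<comment> \<open>Taken from the bounds on the empty prefix sum, which also cover
    \<open>n = 0\<close>.\<close>
  have B: "0 \<le> B"
    using red_p_bounds[OF assms(1,2), of 0 M] by linarith
  have "4 * B \<le> (4 * int n + 8) * B"
    using B by (intro mult_right_mono) auto
  \<comment> \<open>Since prefix sums are at most \<open>2 * B\<close>, this keeps each
    \<open>M - 2 * p\<close> nonnegative, and likewise the length \<open>M - 2 * B\<close> of the
    long job.\<close>
  then have M: "4 * B < M"
    using assms(3) by linarith
  have p_nonneg: "0 \<le> ?p k" for k
    using red_p_bounds(1)[OF assms(1,2), of k M] M B
    by (cases "k \<le> 2 * n + 1") (auto simp: red_p_def)
  have d_nonneg: "0 \<le> ?d k" for k
    using red_p_bounds(2)[OF assms(1,2), of k M] M by (auto simp: red_delta_def)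
  have d_le: "?d (?l k) \<le> (\<Sum>i<Suc n. ?d i)" if "k \<le> n" for k
  proof -
    \<comment> \<open>An index in \<open>{0..n}\<close> with the same deterioration, passing to the
      twin where necessary; it makes the value one summand of the maximum level.\<close>
    define i where "i = (if k \<in> S then k - 1 else k)"
    have "i \<le> n" "?d (?l k) = ?d i"
      using that red_p_twin[OF that, of x B M]
      by (auto simp: i_def late_job_def red_delta_def)
    then show ?thesis
      using d_nonneg member_le_sum[of i "{..<Suc n}" ?d] by simp
  qed
  note part = early_late_partition[OF S(1)]
  have js: "jobs_of as = map ?e [0..<Suc n] @ (2 * n + 2) # map ?l (rev [0..<Suc n])"
    unfolding as_def early_def late_def
    by (simp only: jobs_of_append jobs_of.simps jobs_of_map_Job jobs_of_maintained)
  have img: "set (map ?e [0..<Suc n]) = ?e ` {0..<Suc n}"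
    "set (map ?l (rev [0..<Suc n])) = ?l ` {0..<Suc n}"
    by (simp_all only: set_map set_rev set_upt)
  have feas: "feasible I (schedule_from I 0 as)"
  proof (rule feasible_schedule_from)
    have "2 * n + 2 \<notin> ?e ` {0..<Suc n} \<union> ?l ` {0..<Suc n}"
      unfolding part(4) by simp
    moreover have "distinct (map ?e [0..<Suc n])" "distinct (map ?l (rev [0..<Suc n]))"
      using part(1,2) by (simp_all only: distinct_map distinct_rev distinct_upt set_rev set_upt simp_thms)
    ultimately show "distinct (jobs_of as)"
      unfolding js distinct_append distinct.simps list.set img
      by (simp only: Int_insert_right part(3) Un_iff de_Morgan_disj simp_thms if_False)
    have "set (jobs_of as) = insert (2 * n + 2) (?e ` {0..<Suc n} \<union> ?l ` {0..<Suc n})"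
      unfolding js set_append list.set img by blast
    also have "\<dots> = jobs I"
      unfolding part(4) I(1) by auto
    finally show "set (jobs_of as) = jobs I" .
    show "0 \<le> duration I a" if "a \<in> set as" for a
      using that p_nonneg d_nonneg by (auto simp: as_def early_def late_def I)
    \<comment> \<open>The early run consumes exactly the initial level. The long job has no
      deterioration, so it runs at level 0 and the late run starts from 0.\<close>
    have "(\<Sum>k\<leftarrow>[0..<Suc n]. deter I (?e k)) = (\<Sum>k<Suc n. deter I (?e k))"
      by (simp only: sum_list_distinct_conv_sum_set[OF distinct_upt] set_upt atLeast0LessThan)
    also have "\<dots> = ml_init I"
      using sum_red_delta_early_job[OF S, of M] by (simp only: I flip: of_int_sum)
    finally have used: "(\<Sum>k\<leftarrow>[0..<Suc n]. deter I (?e k)) = ml_init I" .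
    have "levels_ok I 0 late"
      unfolding late_def using d_nonneg d_le
      by (intro levels_ok_maintained) (auto simp: I simp del: sum.lessThan_Suc of_int_sum)
    moreover have "deter I (2 * n + 2) = 0"
      by (simp add: I red_delta_def)
    ultimately show "levels_ok I (ml_init I) as"
      unfolding as_def early_def
      by (intro levels_ok_map_Job_append) (simp_all only: used, simp_all add: I d_nonneg)
  qed
  have dur: "sum_list (map (duration I) early) = (\<Sum>k<Suc n. ptime I (?e k))"
    by (simp only: early_def map_map o_def duration.simps
        sum_list_distinct_conv_sum_set[OF distinct_upt] set_upt atLeast0LessThan)
  \<comment> \<open>The completion of the long job counts once for itself and once for each of the
    \<open>n + 1\<close> late jobs it delays, giving the factor \<open>n + 2\<close>.\<close>
  have "sum_completions I (schedule_from I 0 as) =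
      (\<Sum>j<Suc n. (real (Suc n) - real j) * ptime I (?e j))
      + (real n + 2) * ((\<Sum>j<Suc n. ptime I (?e j)) + ptime I (2 * n + 2))
      + (\<Sum>j<Suc n. (real j + 1) * (deter I (?l j) + ptime I (?l j)))"
    unfolding as_def sum_completions_append sum_completions_Job_Cons dur
    unfolding early_def late_def sum_completions_map_Job sum_completions_maintained
    by (simp add: algebra_simps del: sum.lessThan_Suc)
  also have "\<dots> = real_of_int (Q0 n x B M + B)"
    unfolding swapped_cost[OF S, symmetric] I by (simp del: sum.lessThan_Suc)
  finally show ?thesis
    using feas total_completion_time_eq[OF feas] unfolding I_def by auto
qed

end
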